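(* Let $n\ge 1$ be an integer, put $C=(n+2)^2+1$, and let $N=\{1,\dots,2n+2\}\cup\{n^2+2n+3,\dots,(n+2)^2\}$. For $x\in N$ write $\bar x=C-x$, and for $x,y\in N$ write $d_{xy}=x+y-C$. Let $v,w,b_1,\dots,b_n,c_1,\dots,c_n$ be $2n+2$ elements of $N$ such that no two of them are equal and no two of them are complementary, so that $\{v,w,b_1,\dots,b_n,c_1,\dots,c_n\}$ together with the complements $\{\bar v,\bar w,\bar b_1,\dots,\bar b_n,\bar c_1,\dots,\bar c_n\}$ is exactly $N$. Assume: (i) if $n$ is even: the $n+2$ numbers $v,w,b_1,\dots,b_n$ can be partitioned into $(n+2)/2$ pairs $\beta$ with $\sum_{(x,y)\in\beta}d_{xy}=0$, and the $n$ numbers $c_1,\dots,c_n$ can be partitioned into $n/2$ pairs $\gamma$ with $\sum_{(x,y)\in\gamma}d_{xy}=-d_{v\bar w}$; (ii) if $n$ is odd: setting $d_v=v-\frac{C}{2}$, the $n+1$ numbers $b_1,\dots,b_n,w$ can be partitioned into $(n+1)/2$ pairs $\beta$ with $\sum_{(x,y)\in\beta}d_{xy}+d_v=0$, and the $n+1$ numbers $c_1,\dots,c_n,\bar w$ can be partitioned into $(n+1)/2$ pairs $\gamma$ with $\sum_{(x,y)\in\gamma}d_{xy}+d_v=0$. Place these numbers in the border cells of an $(n+2)\times(n+2)$ array as follows: top row $v,b_1,\dots,b_n,w$ (left to right); bottom row $\bar w,\bar b_1,\dots,\bar b_n,\bar v$ (left to right); left column between the corners $c_1,\dots,c_n$ (top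 to bottom); right column between the corners $\bar c_1,\dots,\bar c_n$ (top to bottom). Then the resulting border is a magic border, i.e. each of its first row, last row, first column and last column has sum $S_{n+2}=\frac{n+2}{2}\big((n+2)^2+1\big)$.
   Context: The border of an $(n+2)\times(n+2)$ array is the set of cells in its first and last row and first and last column. Two numbers $a,b$ are complementary if $a+b=(n+2)^2+1$. A magic border (surrounding an inner square of order $n$) is a filling of the border cells with numbers such that every pair of opposite cells (the two diagonally opposite corners, and the two cells in the same column of the top and bottom rows, and the two cells in the same row of the left and right columns) contains complementary numbers and each of the four border lines sums to $S_{n+2}=\frac{n+2}{2}((n+2)^2+1)$, the magic constant of order $n+2$. *)

theory Defs
  imports Complex_Main "HOL-Library.Disjoint_Sets"
begin

text \<open>
  Throughout, \<open>n\<close> is the order of the inner square; rows and columns of the surrounding array are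
  numbered \<open>1, \<dots>, n + 2\<close>. Entries are integers. Halves are taken in the reals.
\<close>

definition comp_const :: "nat \<Rightarrow> int" where
  "comp_const n = (int n + 2)\<^sup>2 + 1"

definition complementary :: "nat \<Rightarrow> int \<Rightarrow> int \<Rightarrow> bool" where
  "complementary n a b \<longleftrightarrow> a + b = comp_const n"

definition compl :: "nat \<Rightarrow> int \<Rightarrow> int" where
  "compl n x = comp_const n - x"

definition pair_dev :: "nat \<Rightarrow> int \<Rightarrow> int \<Rightarrow> int" where
  "pair_dev n x y = x + y - comp_const n"

definition single_dev :: "nat \<Rightarrow> int \<Rightarrow> real" where
  "single_dev n x = real_of_int x - real_of_int (comp_const n) / 2"

definition border_numbers :: "nat \<Rightarrow> int set" where
  "border_numbers n = {1..2 * int n + 2} \<union> {(int n)\<^sup>2 + 2 * int n + 3..(int n + 2)\<^sup>2}"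

text \<open>The argument is the order of the square itself, not that of the inner square.\<close>

definition magic_const :: "nat \<Rightarrow> real" where
  "magic_const m = real m / 2 * ((real m)\<^sup>2 + 1)"

text \<open>
  A pair is represented by \<open>(x, y)\<close> in either order; disjointness of the two-element sets \<open>{x, y}\<close>
  excludes listing both orders.
\<close>

definition pair_partition :: "'a set \<Rightarrow> ('a \<times> 'a) set \<Rightarrow> bool" where
  "pair_partition X P \<longleftrightarrow>
     (\<forall>(x, y)\<in>P. x \<noteq> y) \<and>
     disjoint_family_on (\<lambda>(x, y). {x, y}) P \<and>
     (\<Union>(x, y)\<in>P. {x, y}) = X"

text \<open>
  Only the values of the array \<open>A\<close> (row index first) on its border cells matter.
\<close>

definition magic_border :: "nat \<Rightarrow> (nat \<Rightarrow> nat \<Rightarrow> int) \<Rightarrow> bool" where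
  "magic_border n A \<longleftrightarrow>
     complementary n (A 1 1) (A (n + 2) (n + 2)) \<and>
     complementary n (A 1 (n + 2)) (A (n + 2) 1) \<and>
     (\<forall>j\<in>{2..n + 1}. complementary n (A 1 j) (A (n + 2) j)) \<and>
     (\<forall>i\<in>{2..n + 1}. complementary n (A i 1) (A i (n + 2))) \<and>
     real_of_int (\<Sum>j = 1..n + 2. A 1 j) = magic_const (n + 2) \<and>
     real_of_int (\<Sum>j = 1..n + 2. A (n + 2) j) = magic_const (n + 2) \<and>
     real_of_int (\<Sum>i = 1..n + 2. A i 1) = magic_const (n + 2) \<and>
     real_of_int (\<Sum>i = 1..n + 2. A i (n + 2)) = magic_const (n + 2)"

definition entries :: "nat \<Rightarrow> int \<Rightarrow> int \<Rightarrow> (nat \<Rightarrow> int) \<Rightarrow> (nat \<Rightarrow> int) \<Rightarrow> int list" where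
  "entries n v w b c = v # w # map b [1..<n + 1] @ map c [1..<n + 1]"

lemma card_pair_partition:
  assumes "pair_partition X P" "finite X"
  shows "card X = 2 * card P"
proof -
  have X: "(\<Union>p\<in>P. {fst p, snd p}) = X"
    using assms(1) by (simp add: pair_partition_def case_prod_beta)
  have ne: "fst p \<noteq> snd p" if "p \<in> P" for p
    using assms(1) that by (auto simp: pair_partition_def)
  have disj: "{fst p, snd p} \<inter> {fst q, snd q} = {}" if "p \<in> P" "q \<in> P" "p \<noteq> q" for p q
    using assms(1) that unfolding pair_partition_def disjoint_family_on_def case_prod_beta by blast
  have "P \<subseteq> X \<times> X"
  proof
    fix p assume "p \<in> P"
    hence "fst p \<in> X" "snd p \<in> X" unfolding X[symmetric] by blast+
    thus "p \<in> X \<times> X" by (simp add: mem_Times_iff)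
  qed
  hence fin: "finite P" using assms(2) finite_subset by blast
  have "card (\<Union>p\<in>P. {fst p, snd p}) = (\<Sum>p\<in>P. card {fst p, snd p})"
    by (rule card_UN_disjoint[OF fin]) (use disj in \<open>blast+\<close>)
  also have "\<dots> = (\<Sum>p\<in>P. 2)" using ne by (intro sum.cong) auto
  finally show ?thesis using X by simp
qed

text \<open>
  Distinct, pairwise non-complementary entries from \<open>border_numbers n\<close> and their complements
  together automatically exhaust \<open>border_numbers n\<close>.
\<close>

lemma entries_exhaust:
  assumes n: "n \<ge> 1"
    and sub: "set (entries n v w b c) \<subseteq> border_numbers n"
    and dist: "distinct (entries n v w b c)"
    and ncomp: "pairwise (\<lambda>x y. \<not> complementary n x y) (set (entries n v w b c))"
  shows "set (entries n v w b c) \<union> compl n ` set (entries n v w b c) = border_numbers n"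
proof -
  let ?E = "set (entries n v w b c)"
  have cC: "compl n x \<in> border_numbers n" if "x \<in> border_numbers n" for x
  proof -
    have "(int n + 2)\<^sup>2 = (int n)\<^sup>2 + 4 * int n + 4" by (simp add: power2_eq_square algebra_simps)
    thus ?thesis using that unfolding border_numbers_def compl_def comp_const_def by simp linarith
  qed
  have self: "x + x \<noteq> comp_const n" if "x \<in> border_numbers n" for x
  proof -
    have "(int n + 2)\<^sup>2 = (int n)\<^sup>2 + 4 * int n + 4" by (simp add: power2_eq_square algebra_simps)
    moreover have "(int n)\<^sup>2 \<ge> 1" using n by simp
    ultimately show ?thesis using that n
      unfolding border_numbers_def comp_const_def Un_iff atLeastAtMost_iff by linarith
  qed
  have disj: "?E \<inter> compl n ` ?E = {}"
  proof (rule ccontr)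
    assume "?E \<inter> compl n ` ?E \<noteq> {}"
    then obtain x y where xy: "x \<in> ?E" "y \<in> ?E" "x = compl n y" by blast
    hence "complementary n x y" by (simp add: complementary_def compl_def)
    with xy ncomp have "x = y" by (auto simp: pairwise_def)
    with \<open>complementary n x y\<close> self sub xy show False by (auto simp: complementary_def)
  qed
  have inj: "inj_on (compl n) ?E" by (auto simp: inj_on_def compl_def)
  have cE: "card ?E = 2 * n + 2"
    using distinct_card[OF dist] by (simp add: entries_def)
  have "card (?E \<union> compl n ` ?E) = 4 * n + 4"
    using card_Un_disjoint[OF _ _ disj] card_image[OF inj] cE by simp
  moreover have "card (border_numbers n) = 4 * n + 4"
  proof -
    have "2 * int n + 2 < (int n)\<^sup>2 + 2 * int n + 3"
      using zero_le_power2[of "int n"] by linarith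
    hence "{1..2 * int n + 2} \<inter> {(int n)\<^sup>2 + 2 * int n + 3..(int n + 2)\<^sup>2} = {}"
      by (simp only: disjoint_iff atLeastAtMost_iff) linarith
    hence "card (border_numbers n) = card {1..2 * int n + 2}
        + card {(int n)\<^sup>2 + 2 * int n + 3..(int n + 2)\<^sup>2}"
      unfolding border_numbers_def by (intro card_Un_disjoint) auto
    also have "\<dots> = nat (2 * int n + 2) + nat (2 * int n + 2)"
      by (simp add: power2_eq_square algebra_simps)
    finally show ?thesis by simp
  qed
  moreover have "?E \<union> compl n ` ?E \<subseteq> border_numbers n" using sub cC by blast
  moreover have "finite (border_numbers n)" by (simp add: border_numbers_def)
  ultimately show ?thesis by (metis card_subset_eq)
qed

end

theory Submission
  imports Defs
begin

text \<open>
  Measure every entry by its deviation from \<open>C / 2\<close>, so that \<open>d\<^bsub>xy\<^esub> = d\<^sub>x + d\<^sub>y\<close> and complementary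
  entries have opposite deviations. A line of \<open>n + 2\<close> entries has the magic sum iff its deviations
  add up to 0, and a sum of \<open>d\<^bsub>xy\<^esub>\<close> over a partition into pairs is the sum of the deviations of all
  elements, whichever partition is used. For both parities the hypotheses therefore say precisely
  that the deviations of the top row and of the left column sum to 0; the other two lines consist
  of the complementary entries.
\<close>

text \<open>The blocks are disjoint and cover \<open>X\<close>, so the sum over \<open>X\<close>
  splits into block sums; since \<open>x \<noteq> y\<close> in each pair, a block contributes both
  of its terms.\<close>

lemma sum_pair_partition:
  assumes "pair_partition X P" "finite X"
  shows "(\<Sum>(x, y)\<in>P. f x + f y) = sum f X"
proof -
  have X: "X = (\<Union>p\<in>P. {fst p, snd p})"
    using assms(1) by (simp add: pair_partition_def case_prod_beta)
  have ne: "fst p \<noteq> snd p" if "p \<in> P" for p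
    using assms(1) that by (auto simp: pair_partition_def)
  have disj: "{fst p, snd p} \<inter> {fst q, snd q} = {}" if "p \<in> P" "q \<in> P" "p \<noteq> q" for p q
    using assms(1) that unfolding pair_partition_def disjoint_family_on_def case_prod_beta by blast
  \<comment> \<open>\<open>P\<close> inherits finiteness from \<open>X\<close>, as splitting a sum
    over a union requires a finite index set.\<close>
  have "P \<subseteq> X \<times> X"
    by (force simp: X)
  hence fin: "finite P"
    using assms(2) finite_subset by blast
  have "sum f X = (\<Sum>p\<in>P. sum f {fst p, snd p})"
    unfolding X by (rule sum.UNION_disjoint[OF fin]) (use disj in \<open>blast+\<close>)
  also have "\<dots> = (\<Sum>p\<in>P. f (fst p) + f (snd p))"
    using ne by (intro sum.cong) auto
  finally show ?thesis
    by (simp add: case_prod_beta)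
qed

lemma pair_dev_eq_single_dev: "real_of_int (pair_dev n x y) = single_dev n x + single_dev n y"
  by (simp add: pair_dev_def single_dev_def)

lemma single_dev_compl: "single_dev n (compl n x) = - single_dev n x"
  by (simp add: single_dev_def compl_def)

lemma sum_pair_dev:
  assumes "pair_partition X P" "finite X"
  shows "real_of_int (\<Sum>(x, y)\<in>P. pair_dev n x y) = sum (single_dev n) X"
  using sum_pair_partition[OF assms, of "single_dev n"]
  by (simp add: case_prod_beta pair_dev_eq_single_dev)

text \<open>Passing to deviations subtracts C/2 from each of the n + 2 entries, and (n + 2) C/2 is
  exactly the magic constant.\<close>

lemma sum_eq_magic_const_iff:
  "real_of_int (\<Sum>j = 1..n + 2. f j) = magic_const (n + 2)
     \<longleftrightarrow> (\<Sum>j = 1..n + 2. single_dev n (f j)) = 0"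
proof -
  have "(\<Sum>j = 1..n + 2. single_dev n (f j))
      = real_of_int (\<Sum>j = 1..n + 2. f j) - real (n + 2) * (real_of_int (comp_const n) / 2)"
    unfolding single_dev_def sum_subtractf by simp
  also have "real (n + 2) * (real_of_int (comp_const n) / 2) = magic_const (n + 2)"
    by (simp add: magic_const_def comp_const_def)
  finally show ?thesis
    by linarith
qed

lemma sum_line_split:
  fixes f :: "nat \<Rightarrow> 'a::comm_monoid_add"
  shows "(\<Sum>j = 1..n + 2. f j) = f 1 + (\<Sum>j = 1..n. f (j + 1)) + f (n + 2)"
  by (induction n) (simp_all add: ac_simps)

text \<open>Separates the two corners from the inner cells, whose positions are shifted by one
  against the indices of \<open>b\<close> and \<open>c\<close>.\<close>

lemma magic_line_iff:
  assumes "\<And>j. j \<in> {1..n} \<Longrightarrow> f (j + 1) = g j"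
  shows "real_of_int (\<Sum>j = 1..n + 2. f j) = magic_const (n + 2)
     \<longleftrightarrow> single_dev n (f 1) + (\<Sum>j = 1..n. single_dev n (g j)) + single_dev n (f (n + 2)) = 0"
  unfolding sum_eq_magic_const_iff unfolding sum_line_split using assms by simp

theorem theorem1:
  fixes n :: nat and v w :: int and b c :: "nat \<Rightarrow> int" and A :: "nat \<Rightarrow> nat \<Rightarrow> int"
  assumes "n \<ge> 1"
    and "set (entries n v w b c) \<subseteq> border_numbers n"
    and "distinct (entries n v w b c)"
    and "pairwise (\<lambda>x y. \<not> complementary n x y) (set (entries n v w b c))"
    and "even n \<Longrightarrow>
      (\<exists>P. pair_partition ({v, w} \<union> b ` {1..n}) P \<and> (\<Sum>(x, y)\<in>P. pair_dev n x y) = 0) \<and>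
      (\<exists>Q. pair_partition (c ` {1..n}) Q \<and>
           (\<Sum>(x, y)\<in>Q. pair_dev n x y) = - pair_dev n v (compl n w))"
    and "odd n \<Longrightarrow>
      (\<exists>P. pair_partition (b ` {1..n} \<union> {w}) P \<and>
           real_of_int (\<Sum>(x, y)\<in>P. pair_dev n x y) + single_dev n v = 0) \<and>
      (\<exists>Q. pair_partition (c ` {1..n} \<union> {compl n w}) Q \<and>
           real_of_int (\<Sum>(x, y)\<in>Q. pair_dev n x y) + single_dev n v = 0)"
    and "A 1 1 = v" and "A 1 (n + 2) = w"
    and "A (n + 2) 1 = compl n w" and "A (n + 2) (n + 2) = compl n v"
    and "\<And>j. j \<in> {1..n} \<Longrightarrow> A 1 (j + 1) = b j"
    and "\<And>j. j \<in> {1..n} \<Longrightarrow> A (n + 2) (j + 1) = compl n (b j)"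
    and "\<And>i. i \<in> {1..n} \<Longrightarrow> A (i + 1) 1 = c i"
    and "\<And>i. i \<in> {1..n} \<Longrightarrow> A (i + 1) (n + 2) = compl n (c i)"
  shows "magic_border n A"
proof -
  let ?d = "single_dev n"
  note parts = assms(5,6)
  note corners = assms(7-10)
  note sides = assms(11-14)
  \<comment> \<open>The partitions concern sets while the lines are indexed sums; distinctness keeps
    any term from being lost between the two.\<close>
  have dist: "v \<noteq> w" "inj_on b {1..n}" "inj_on c {1..n}"
      "v \<notin> b ` {1..n}" "w \<notin> b ` {1..n}" "w \<notin> c ` {1..n}"
    using assms(3) by (auto simp: entries_def distinct_map atLeastLessThanSuc_atLeastAtMost
        simp del: upt_Suc)
  \<comment> \<open>In the odd case this keeps the complement of \<open>w\<close> from being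
    absorbed into the set of the \<open>c i\<close>. Since \<open>pairwise\<close> speaks only of
    different elements, \<open>c i \<noteq> w\<close> has to be established first.\<close>
  have compl_w: "compl n w \<notin> c ` {1..n}"
  proof
    assume "compl n w \<in> c ` {1..n}"
    then obtain i where i: "i \<in> {1..n}" "c i = compl n w"
      by auto
    have "c i \<noteq> w"
      using dist i(1) by auto
    moreover have "c i \<in> set (entries n v w b c)" "w \<in> set (entries n v w b c)"
      using i(1) by (simp_all add: entries_def del: upt_Suc)
    ultimately have "\<not> complementary n (c i) w"
      using assms(4) by (simp add: pairwise_def)
    thus False
      by (simp add: i(2) complementary_def compl_def)
  qed
  have sum_b: "sum ?d (b ` {1..n}) = (\<Sum>j = 1..n. ?d (b j))"
    and sum_c: "sum ?d (c ` {1..n}) = (\<Sum>j = 1..n. ?d (c j))"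
    using dist by (simp_all add: sum.reindex)
  have row: "?d v + (\<Sum>j = 1..n. ?d (b j)) + ?d w = 0"
    and col: "?d v + (\<Sum>j = 1..n. ?d (c j)) - ?d w = 0"
  proof (atomize (full), cases "even n")
    case True
    then obtain P Q where
      P: "pair_partition ({v, w} \<union> b ` {1..n}) P" "(\<Sum>(x, y)\<in>P. pair_dev n x y) = 0" and
      Q: "pair_partition (c ` {1..n}) Q"
        "(\<Sum>(x, y)\<in>Q. pair_dev n x y) = - pair_dev n v (compl n w)"
      using parts(1) by blast
    have "sum ?d ({v, w} \<union> b ` {1..n}) = 0"
      using sum_pair_dev[OF P(1), of n] P(2) by simp
    \<comment> \<open>The deviation of the pair formed by \<open>v\<close> and the complement of
      \<open>w\<close> is \<open>?d v - ?d w\<close>, the contribution of the two corners of the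
      left column.\<close>
    moreover have "sum ?d (c ` {1..n}) = - (?d v - ?d w)"
      using sum_pair_dev[OF Q(1), of n] Q(2) by (simp add: pair_dev_eq_single_dev single_dev_compl)
    ultimately show "?d v + (\<Sum>j = 1..n. ?d (b j)) + ?d w = 0 \<and>
        ?d v + (\<Sum>j = 1..n. ?d (c j)) - ?d w = 0"
      using dist sum_b sum_c by simp
  next
    case False
    then obtain P Q where
      P: "pair_partition (b ` {1..n} \<union> {w}) P"
        "real_of_int (\<Sum>(x, y)\<in>P. pair_dev n x y) + ?d v = 0" and
      Q: "pair_partition (c ` {1..n} \<union> {compl n w}) Q"
        "real_of_int (\<Sum>(x, y)\<in>Q. pair_dev n x y) + ?d v = 0"
      using parts(2) by blast
    have "sum ?d (b ` {1..n} \<union> {w}) + ?d v = 0"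
      using sum_pair_dev[OF P(1), of n] P(2) by simp
    moreover have "sum ?d (c ` {1..n} \<union> {compl n w}) + ?d v = 0"
      using sum_pair_dev[OF Q(1), of n] Q(2) by simp
    ultimately show "?d v + (\<Sum>j = 1..n. ?d (b j)) + ?d w = 0 \<and>
        ?d v + (\<Sum>j = 1..n. ?d (c j)) - ?d w = 0"
      using dist compl_w sum_b sum_c by (simp add: single_dev_compl)
  qed
  have opp: "complementary n (A 1 j) (A (n + 2) j)" "complementary n (A j 1) (A j (n + 2))"
    if j: "j \<in> {2..n + 1}" for j
  proof -
    obtain k where k: "k \<in> {1..n}" "j = k + 1"
      using j by (intro that[of "j - 1"]) auto
    show "complementary n (A 1 j) (A (n + 2) j)" "complementary n (A j 1) (A j (n + 2))"
      unfolding k(2) sides[OF k(1)] by (simp_all add: complementary_def compl_def)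
  qed
  have "real_of_int (\<Sum>j = 1..n + 2. A 1 j) = magic_const (n + 2)"
    using row magic_line_iff[where n = n and f = "A 1" and g = b, OF sides(1)]
    by (simp only: corners)
  \<comment> \<open>The bottom row carries the negated deviations of the top row with the corners
    exchanged, so its sum is the negative of \<open>row\<close>.\<close>
  moreover have "real_of_int (\<Sum>j = 1..n + 2. A (n + 2) j) = magic_const (n + 2)"
    using row magic_line_iff[where n = n and f = "A (n + 2)" and g = "\<lambda>j. compl n (b j)",
        OF sides(2)]
    unfolding corners single_dev_compl sum_negf by linarith
  moreover have "real_of_int (\<Sum>i = 1..n + 2. A i 1) = magic_const (n + 2)"
    using col magic_line_iff[where n = n and f = "\<lambda>i. A i 1" and g = c, OF sides(3)]
    unfolding corners single_dev_compl by linarith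
  \<comment> \<open>The corners are now \<open>w\<close> and the complement of \<open>v\<close>, so
    the deviations sum to the negative of \<open>col\<close>.\<close>
  moreover have "real_of_int (\<Sum>i = 1..n + 2. A i (n + 2)) = magic_const (n + 2)"
    using col magic_line_iff[where n = n and f = "\<lambda>i. A i (n + 2)" and g = "\<lambda>i. compl n (c i)",
        OF sides(4)]
    unfolding corners single_dev_compl sum_negf by linarith
  moreover have "complementary n (A 1 1) (A (n + 2) (n + 2))"
      "complementary n (A 1 (n + 2)) (A (n + 2) 1)"
    unfolding corners by (simp_all add: complementary_def compl_def)
  ultimately show ?thesis
    using opp unfolding magic_border_def by blast
qed

end
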